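(* Consider a network contribution game with uniform budgets ($B_v=1$ for all $v\in V$) and reward functions $f_e(x,y)=h_e(\min(x,y))$ for all $e\in E$, where all $h_e$ are convex. Then a pairwise equilibrium always exists. If all $h_e$ are strictly convex, then all pairwise equilibria are integral.
   Context: Network contribution game: a finite simple undirected graph $G=(V,E)$; every node $v\in V$ is a player with budget $B_v\ge 0$. Let $E_v$ be the set of edges incident to $v$. A strategy of $v$ is a function $s_v:E_v\to\mathbb{R}_{\ge 0}$ with $\sum_{e\in E_v}s_v(e)\le B_v$; a state $s=(s_v)_{v\in V}$ consists of one strategy per player. Each edge $e=(u,v)$ has a reward function $f_e:\mathbb{R}_{\ge 0}^2\to\mathbb{R}_{\ge 0}$; here $f_e(x,y)=h_e(\min(x,y))$ with $h_e:\mathbb{R}_{\ge0}\to\mathbb{R}_{\ge0}$ nondecreasing. The utility of $v$ is $w_v(s)=\sum_{e=(v,u)\in E_v}f_e(s_v(e),s_u(e))$. Budgets are uniform if they are all equal; they are then normalized to $1$. A state $s$ is a (pure) Nash equilibrium if $w_v(s)\ge w_v(s_v',s_{-v})$ for every player $v$ and every strategy $s_v'$. An improving bilateral deviation in $s$ is a pair of strategies $(s_u',s_v')$ of two players $u\neq v$ with $w_u(s_u',s_v',s_{-u,v})>w_u(s)$ and $w_v(s_u',s_v',s_{-u,v})>w_v(s)$. A pairwise equilibrium is a Nash equilibrium that admits no improving bilateral deviation. Convention for minimum effort games: since only the minimum contribution to an edge matters, it is assumed without loss of generality that in a pairwise equilibrium $s$ the two endpoints of each edge $e=(u,v)$ contribute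 the same amount $s_e=s_u(e)=s_v(e)$ (in general $s_e=\min(s_u(e),s_v(e))$). A pairwise equilibrium is integral if $s_e\in\{0,1\}$ for all $e\in E$. *)

theory Defs
  imports "HOL-Analysis.Analysis"
begin

text \<open>
  Edges of a simple graph are two-element vertex sets. A state \<open>s\<close> maps a player \<open>v\<close> and an
  edge \<open>e\<close> to the contribution \<open>s v e\<close> of \<open>v\<close> to \<open>e\<close>; only the values at edges incident
  to \<open>v\<close> carry meaning, the others are unconstrained and never used.
\<close>

definition simple_graph :: "'a set \<Rightarrow> 'a set set \<Rightarrow> bool" where
  "simple_graph V E \<longleftrightarrow> finite V \<and> (\<forall>e\<in>E. e \<subseteq> V \<and> card e = 2)"

definition incident_edges :: "'a set set \<Rightarrow> 'a \<Rightarrow> 'a set set" where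
  "incident_edges E v = {e \<in> E. v \<in> e}"

definition contribution_game ::
    "'a set \<Rightarrow> 'a set set \<Rightarrow> ('a \<Rightarrow> real) \<Rightarrow> ('a set \<Rightarrow> real \<Rightarrow> real \<Rightarrow> real) \<Rightarrow> bool" where
  "contribution_game V E B f \<longleftrightarrow>
     simple_graph V E \<and> (\<forall>v\<in>V. B v \<ge> 0) \<and> (\<forall>e\<in>E. \<forall>x\<ge>0. \<forall>y\<ge>0. f e x y \<ge> 0)"

definition strategies :: "'a set set \<Rightarrow> ('a \<Rightarrow> real) \<Rightarrow> 'a \<Rightarrow> ('a set \<Rightarrow> real) set" where
  "strategies E B v =
     {t. (\<forall>e\<in>incident_edges E v. t e \<ge> 0) \<and> (\<Sum>e\<in>incident_edges E v. t e) \<le> B v}"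

definition states :: "'a set \<Rightarrow> 'a set set \<Rightarrow> ('a \<Rightarrow> real) \<Rightarrow> ('a \<Rightarrow> 'a set \<Rightarrow> real) set" where
  "states V E B = {s. \<forall>v\<in>V. s v \<in> strategies E B v}"

text \<open>As the graph is simple, summing over the neighbours \<open>u\<close> of \<open>v\<close> is summing over the edges
  at \<open>v\<close>.\<close>

definition utility ::
    "'a set set \<Rightarrow> ('a set \<Rightarrow> real \<Rightarrow> real \<Rightarrow> real) \<Rightarrow> ('a \<Rightarrow> 'a set \<Rightarrow> real) \<Rightarrow> 'a \<Rightarrow> real" where
  "utility E f s v = (\<Sum>u | {v, u} \<in> E. f {v, u} (s v {v, u}) (s u {v, u}))"

definition nash_equilibrium ::
    "'a set \<Rightarrow> 'a set set \<Rightarrow> ('a \<Rightarrow> real) \<Rightarrow> ('a set \<Rightarrow> real \<Rightarrow> real \<Rightarrow> real) \<Rightarrow>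
     ('a \<Rightarrow> 'a set \<Rightarrow> real) \<Rightarrow> bool" where
  "nash_equilibrium V E B f s \<longleftrightarrow> s \<in> states V E B \<and>
     (\<forall>v\<in>V. \<forall>t\<in>strategies E B v. utility E f s v \<ge> utility E f (s(v := t)) v)"

definition improving_bilateral_deviation ::
    "'a set set \<Rightarrow> ('a \<Rightarrow> real) \<Rightarrow> ('a set \<Rightarrow> real \<Rightarrow> real \<Rightarrow> real) \<Rightarrow>
     ('a \<Rightarrow> 'a set \<Rightarrow> real) \<Rightarrow> 'a \<Rightarrow> 'a \<Rightarrow> ('a set \<Rightarrow> real) \<Rightarrow> ('a set \<Rightarrow> real) \<Rightarrow> bool" where
  "improving_bilateral_deviation E B f s u v t\<^sub>u t\<^sub>v \<longleftrightarrow>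
     u \<noteq> v \<and> t\<^sub>u \<in> strategies E B u \<and> t\<^sub>v \<in> strategies E B v \<and>
     utility E f (s(u := t\<^sub>u, v := t\<^sub>v)) u > utility E f s u \<and>
     utility E f (s(u := t\<^sub>u, v := t\<^sub>v)) v > utility E f s v"

definition pairwise_equilibrium ::
    "'a set \<Rightarrow> 'a set set \<Rightarrow> ('a \<Rightarrow> real) \<Rightarrow> ('a set \<Rightarrow> real \<Rightarrow> real \<Rightarrow> real) \<Rightarrow>
     ('a \<Rightarrow> 'a set \<Rightarrow> real) \<Rightarrow> bool" where
  "pairwise_equilibrium V E B f s \<longleftrightarrow> nash_equilibrium V E B f s \<and>
     \<not> (\<exists>u\<in>V. \<exists>v\<in>V. \<exists>t\<^sub>u t\<^sub>v. improving_bilateral_deviation E B f s u v t\<^sub>u t\<^sub>v)"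

text \<open>The convention for minimum effort games: both endpoints of an edge contribute the same
  amount.\<close>

definition equal_contributions :: "'a set set \<Rightarrow> ('a \<Rightarrow> 'a set \<Rightarrow> real) \<Rightarrow> bool" where
  "equal_contributions E s \<longleftrightarrow> (\<forall>e\<in>E. \<forall>u\<in>e. \<forall>v\<in>e. s u e = s v e)"

text \<open>The amount $s_e$. It is the common contribution of the endpoints if these agree, and is the
  minimum of the two in general.\<close>

definition edge_contribution :: "('a \<Rightarrow> 'a set \<Rightarrow> real) \<Rightarrow> 'a set \<Rightarrow> real" where
  "edge_contribution s e = (MIN v\<in>e. s v e)"

definition integral_state :: "'a set set \<Rightarrow> ('a \<Rightarrow> 'a set \<Rightarrow> real) \<Rightarrow> bool" where
  "integral_state E s \<longleftrightarrow> (\<forall>e\<in>E. edge_contribution s e \<in> {0, 1})"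

definition strictly_convex_on :: "'a::real_vector set \<Rightarrow> ('a \<Rightarrow> real) \<Rightarrow> bool" where
  "strictly_convex_on S f \<longleftrightarrow> convex S \<and>
     (\<forall>x\<in>S. \<forall>y\<in>S. \<forall>u>0. \<forall>v>0. x \<noteq> y \<longrightarrow> u + v = 1 \<longrightarrow>
        f (u *\<^sub>R x + v *\<^sub>R y) < u * f x + v * f y)"

end

theory Submission
  imports Defs
begin

text \<open>
  Write \<open>a\<^sub>e = h\<^sub>e(1) - h\<^sub>e(0)\<close>. By convexity an edge of contribution \<open>x \<le> 1\<close> yields at most
  \<open>h\<^sub>e(0) + x a\<^sub>e\<close>, so a player with unit budget gains at most the largest \<open>a\<^sub>e\<close> among the edges
  in use over contributing nothing. Existence: take a greedy matching by decreasing \<open>a\<^sub>e\<close> and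
  let matched players contribute everything to their edge; in every deviation some deviating
  player already has an edge with the largest gain available. Integrality: if some edges are
  fractional, take one with maximal \<open>a\<^sub>e\<close>; by strictness both endpoints gain less than
  \<open>a\<^sub>e\<close>, so both improve by moving their whole budget to it.
\<close>

section \<open>Chord inequalities on the unit interval, weighted sums and greedy matchings\<close>

lemma convex_on_le_chord:
  fixes g :: "real \<Rightarrow> real"
  assumes "convex_on {0..} g" "0 \<le> x" "x \<le> 1"
  shows "g x \<le> g 0 + x * (g 1 - g 0)"
  using convex_onD[OF assms(1), of x 0 1] assms(2,3) by (simp add: algebra_simps)

lemma strictly_convex_on_less_chord:
  fixes g :: "real \<Rightarrow> real"
  assumes "strictly_convex_on {0..} g" "0 < x" "x < 1"
  shows "g x < g 0 + x * (g 1 - g 0)"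
proof -
  have "g ((1 - x) *\<^sub>R 0 + x *\<^sub>R 1) < (1 - x) * g 0 + x * g 1"
    using assms unfolding strictly_convex_on_def
    by (smt (verit) atLeast_iff zero_less_one)
  then show ?thesis
    by (simp add: algebra_simps)
qed

lemma weighted_sum_le:
  fixes m a :: "'b \<Rightarrow> real"
  assumes "\<And>e. e \<in> A \<Longrightarrow> 0 \<le> m e" "sum m A \<le> 1" "0 \<le> c"
    and "\<And>e. e \<in> A \<Longrightarrow> m e \<noteq> 0 \<Longrightarrow> a e \<le> c"
  shows "(\<Sum>e\<in>A. m e * a e) \<le> c"
proof -
  have "(\<Sum>e\<in>A. m e * a e) \<le> (\<Sum>e\<in>A. m e * c)"
    using assms(1,4) by (intro sum_mono) (metis mult_left_mono mult_zero_left order_refl)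
  also have "\<dots> = sum m A * c"
    by (simp add: sum_distrib_right)
  also have "\<dots> \<le> c"
    using mult_right_mono[OF assms(2,3)] by simp
  finally show ?thesis .
qed

text \<open>Pick a set of maximal \<open>a\<close>, discard all sets meeting it, and recurse: a
  discarded set is dominated by the picked one, any other by the induction hypothesis. The empty set
  is excluded because it meets nothing.\<close>

lemma greedy_matching:
  fixes a :: "'b set \<Rightarrow> real"
  assumes "finite E" "{} \<notin> E"
  shows "\<exists>M\<subseteq>E. disjoint M \<and> (\<forall>e\<in>E. \<exists>e'\<in>M. e \<inter> e' \<noteq> {} \<and> a e \<le> a e')"
  using assms
proof (induction E rule: finite_psubset_induct)
  case (psubset E)
  show ?case
  proof (cases "E = {}")
    case True
    then show ?thesis by (auto simp: disjoint_def)
  next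
    case False
    then have "Max (a ` E) \<in> a ` E"
      using psubset.hyps by simp
    then obtain e0 where e0: "e0 \<in> E" "a e0 = Max (a ` E)"
      by auto
    then have max: "a e \<le> a e0" if "e \<in> E" for e
      using psubset.hyps that by simp
    let ?F = "{e \<in> E. e \<inter> e0 = {}}"
    \<comment> \<open>\<open>e0\<close> is nonempty and so meets itself; this is what makes the
      remaining family strictly smaller.\<close>
    have "e0 \<notin> ?F"
      using e0 psubset.prems by auto
    then have "?F \<subset> E" "{} \<notin> ?F"
      using e0 psubset.prems by blast+
    from psubset.IH[OF this] obtain M where M: "M \<subseteq> ?F" "disjoint M"
      "\<forall>e\<in>?F. \<exists>e'\<in>M. e \<inter> e' \<noteq> {} \<and> a e \<le> a e'"
      by blast
    have "disjoint (insert e0 M)"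
      using M(1,2) by (auto simp: disjoint_def)
    moreover have "\<exists>e'\<in>insert e0 M. e \<inter> e' \<noteq> {} \<and> a e \<le> a e'" if "e \<in> E" for e
      using M(3) max that by (cases "e \<inter> e0 = {}") blast+
    moreover have "insert e0 M \<subseteq> E"
      using M(1) e0(1) by blast
    ultimately show ?thesis by blast
  qed
qed

lemma edge_contribution_doubleton:
  "edge_contribution s {v, u} = min (s v {v, u}) (s u {v, u})"
  by (simp add: edge_contribution_def)

section \<open>Edge contributions and utilities under unit budgets\<close>

locale unit_min_effort_game =
  fixes V :: "'a set" and E :: "'a set set" and B :: "'a \<Rightarrow> real"
    and f :: "'a set \<Rightarrow> real \<Rightarrow> real \<Rightarrow> real" and h :: "'a set \<Rightarrow> real \<Rightarrow> real"
  assumes graph: "simple_graph V E"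
    and uniform: "\<And>v. v \<in> V \<Longrightarrow> B v = 1"
    and min_effort: "\<And>e x y. e \<in> E \<Longrightarrow> 0 \<le> x \<Longrightarrow> 0 \<le> y \<Longrightarrow> f e x y = h e (min x y)"
    and h_mono: "\<And>e. e \<in> E \<Longrightarrow> mono_on {0..} (h e)"
    and h_convex: "\<And>e. e \<in> E \<Longrightarrow> convex_on {0..} (h e)"
begin

definition gain :: "'a set \<Rightarrow> real" where
  "gain e = h e 1 - h e 0"

text \<open>The rewards at contribution 0 are paid in every state, so utilities are compared by
  their excess over this amount.\<close>

definition base_utility :: "'a \<Rightarrow> real" where
  "base_utility v = (\<Sum>e\<in>incident_edges E v. h e 0)"

lemma finite_edges: "finite E"
  using graph unfolding simple_graph_def by (meson Pow_iff finite_Pow_iff finite_subset subsetI)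

lemma finite_incident: "finite (incident_edges E v)"
  using finite_edges by (simp add: incident_edges_def)

lemma edge_subset: "e \<in> E \<Longrightarrow> e \<subseteq> V"
  using graph by (simp add: simple_graph_def)

lemma edge_doubleton:
  assumes "e \<in> E" "v \<in> e"
  obtains u where "e = {v, u}" "u \<noteq> v"
proof -
  have "card e = 2"
    using assms graph by (auto simp: simple_graph_def)
  then obtain x y where "e = {x, y}" "x \<noteq> y"
    by (auto simp: card_2_iff)
  with assms(2) that show ?thesis
    by (auto simp: insert_commute)
qed

lemma gain_nonneg: "e \<in> E \<Longrightarrow> 0 \<le> gain e"
  using h_mono[of e] unfolding gain_def by (auto simp: mono_on_def)

lemma contribution_nonneg:
  assumes "s \<in> states V E B" "e \<in> E" "v \<in> e"
  shows "0 \<le> s v e"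
  using assms edge_subset[of e] by (auto simp: states_def strategies_def incident_edges_def)

lemma edge_contribution_bounds:
  assumes "s \<in> states V E B" "e \<in> E" "v \<in> e"
  shows "0 \<le> edge_contribution s e" "edge_contribution s e \<le> s v e"
proof -
  obtain u where "e = {v, u}"
    using edge_doubleton assms by metis
  then show "0 \<le> edge_contribution s e" "edge_contribution s e \<le> s v e"
    using contribution_nonneg[OF assms(1,2)] by (auto simp: edge_contribution_doubleton)
qed

text \<open>The minima inherit the budget constraint from the player's own contributions. Later
  bounds can thus be stated in edge contributions and also cover deviations, where endpoints may
  contribute unequally.\<close>

lemma sum_edge_contribution_le:
  assumes "s \<in> states V E B" "v \<in> V"
  shows "(\<Sum>e\<in>incident_edges E v. edge_contribution s e) \<le> 1"
proof -
  have "(\<Sum>e\<in>incident_edges E v. edge_contribution s e) \<le> (\<Sum>e\<in>incident_edges E v. s v e)"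
    using edge_contribution_bounds[OF assms(1)] by (intro sum_mono) (auto simp: incident_edges_def)
  also have "\<dots> \<le> 1"
    using assms uniform by (fastforce simp: states_def strategies_def)
  finally show ?thesis .
qed

lemma edge_contribution_le_1:
  assumes "s \<in> states V E B" "e \<in> E" "v \<in> e"
  shows "edge_contribution s e \<le> 1"
proof -
  have "v \<in> V"
    using assms edge_subset by blast
  have "edge_contribution s e \<le> (\<Sum>e\<in>incident_edges E v. edge_contribution s e)"
    using edge_contribution_bounds[OF assms(1)] assms finite_incident
    by (intro member_le_sum) (auto simp: incident_edges_def)
  then show ?thesis
    using sum_edge_contribution_le[OF assms(1) \<open>v \<in> V\<close>] by linarith
qed

text \<open>Mapping a neighbour \<open>u\<close> to \<open>{v, u}\<close> is a bijection onto the
  edges at \<open>v\<close>. Membership in \<open>states\<close> gives the nonnegative arguments at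
  which \<open>f\<close> is known to be \<open>h\<close> of the minimum.\<close>

lemma utility_eq:
  assumes "s \<in> states V E B"
  shows "utility E f s v = (\<Sum>e\<in>incident_edges E v. h e (edge_contribution s e))"
proof -
  have bij: "bij_betw (\<lambda>u. {v, u}) {u. {v, u} \<in> E} (incident_edges E v)"
    unfolding bij_betw_def
  proof
    show "inj_on (\<lambda>u. {v, u}) {u. {v, u} \<in> E}"
      by (auto simp: inj_on_def doubleton_eq_iff)
    show "(\<lambda>u. {v, u}) ` {u. {v, u} \<in> E} = incident_edges E v"
      by (auto simp: incident_edges_def elim: edge_doubleton)
  qed
  have "utility E f s v = (\<Sum>u | {v, u} \<in> E. h {v, u} (edge_contribution s {v, u}))"
    unfolding utility_def edge_contribution_doubleton
    using contribution_nonneg[OF assms] min_effort by (intro sum.cong) auto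
  then show ?thesis
    using sum.reindex_bij_betw[OF bij, of "\<lambda>e. h e (edge_contribution s e)"] by simp
qed

section \<open>Upper bounds on the utility from the gains of the edges in use\<close>

lemma chord_bound:
  assumes "s \<in> states V E B" "e \<in> incident_edges E v"
  shows "h e (edge_contribution s e) \<le> h e 0 + edge_contribution s e * gain e"
  using assms edge_contribution_bounds[OF assms(1)] edge_contribution_le_1[OF assms(1)] h_convex
  unfolding gain_def incident_edges_def by (intro convex_on_le_chord) auto

lemma weighted_gain_le:
  assumes "s \<in> states V E B" "v \<in> V" "0 \<le> c"
    and "\<And>e. e \<in> incident_edges E v \<Longrightarrow> edge_contribution s e \<noteq> 0 \<Longrightarrow> gain e \<le> c"
  shows "(\<Sum>e\<in>incident_edges E v. edge_contribution s e * gain e) \<le> c"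
  using assms edge_contribution_bounds[OF assms(1)] sum_edge_contribution_le
  by (intro weighted_sum_le) (auto simp: incident_edges_def)

lemma utility_le:
  assumes "s \<in> states V E B" "v \<in> V" "0 \<le> c"
    and "\<And>e. e \<in> incident_edges E v \<Longrightarrow> edge_contribution s e \<noteq> 0 \<Longrightarrow> gain e \<le> c"
  shows "utility E f s v \<le> base_utility v + c"
proof -
  have "utility E f s v \<le>
      (\<Sum>e\<in>incident_edges E v. h e 0 + edge_contribution s e * gain e)"
    unfolding utility_eq[OF assms(1)] using chord_bound[OF assms(1)] by (rule sum_mono)
  then show ?thesis
    using weighted_gain_le[OF assms] by (simp add: base_utility_def sum.distrib)
qed

text \<open>Strictness of the chord inequality at the single fractional edge \<open>d\<close> makes
  the whole sum strict.\<close>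

lemma utility_less:
  assumes "s \<in> states V E B" "v \<in> V" "0 \<le> c"
    and "\<And>e. e \<in> incident_edges E v \<Longrightarrow> edge_contribution s e \<noteq> 0 \<Longrightarrow> gain e \<le> c"
    and "d \<in> incident_edges E v" "0 < edge_contribution s d" "edge_contribution s d < 1"
    and "strictly_convex_on {0..} (h d)"
  shows "utility E f s v < base_utility v + c"
proof -
  have "h d (edge_contribution s d) < h d 0 + edge_contribution s d * gain d"
    unfolding gain_def using assms(6-8) by (intro strictly_convex_on_less_chord)
  then have "utility E f s v <
      (\<Sum>e\<in>incident_edges E v. h e 0 + edge_contribution s e * gain e)"
    unfolding utility_eq[OF assms(1)]
    using chord_bound[OF assms(1)] assms(5) finite_incident
    by (intro sum_strict_mono_ex1) auto
  then show ?thesis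
    using weighted_gain_le[OF assms(1-4)] by (simp add: base_utility_def sum.distrib)
qed

lemma states_upd:
  "s \<in> states V E B \<Longrightarrow> t \<in> strategies E B v \<Longrightarrow> s(v := t) \<in> states V E B"
  by (simp add: states_def)

section \<open>Existence: the state of a greedy matching\<close>

definition matching_state :: "'a set set \<Rightarrow> 'a \<Rightarrow> 'a set \<Rightarrow> real" where
  "matching_state M v e = of_bool (e \<in> M)"

lemma matching_state_in_states:
  assumes "disjoint M"
  shows "matching_state M \<in> states V E B"
proof -
  have "(\<Sum>e\<in>incident_edges E v. matching_state M v e) \<le> 1" for v
  proof -
    \<comment> \<open>Two edges of \<open>M\<close> at \<open>v\<close> share \<open>v\<close>, so
      disjointness identifies them: a player spends on at most one edge.\<close>
    have "e = e'" if "e \<in> incident_edges E v \<inter> M" "e' \<in> incident_edges E v \<inter> M" for e e'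
      using that assms by (auto simp: disjoint_def incident_edges_def)
    then have "card (incident_edges E v \<inter> M) \<le> 1"
      using finite_incident by (simp add: card_le_Suc0_iff_eq)
    then show ?thesis
      using finite_incident by (simp add: matching_state_def sum.If_cases of_bool_def Int_def)
  qed
  then show ?thesis
    using uniform by (auto simp: states_def strategies_def matching_state_def)
qed

lemma edge_contribution_matching_state:
  assumes "e \<in> E"
  shows "edge_contribution (matching_state M) e = of_bool (e \<in> M)"
proof -
  obtain v where "v \<in> e"
    using assms graph by (fastforce simp: simple_graph_def)
  then obtain u where "e = {v, u}"
    using edge_doubleton assms by metis
  then show ?thesis
    by (simp add: edge_contribution_doubleton matching_state_def)
qed

text \<open>For disjoint \<open>M\<close> the sum has at most one term; writing it as a sum treats
  matched and unmatched players alike.\<close>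

lemma utility_matching_state:
  assumes "disjoint M"
  shows "utility E f (matching_state M) v = base_utility v + sum gain (incident_edges E v \<inter> M)"
proof -
  have "utility E f (matching_state M) v =
      (\<Sum>e\<in>incident_edges E v. h e 0 + (if e \<in> M then gain e else 0))"
    unfolding utility_eq[OF matching_state_in_states[OF assms]]
    by (intro sum.cong) (auto simp: edge_contribution_matching_state incident_edges_def gain_def)
  then show ?thesis
    using finite_incident by (simp add: sum.distrib base_utility_def sum.inter_restrict)
qed

text \<open>The criterion by which a deviation fails to help \<open>v\<close>: take \<open>c\<close>
  in \<open>utility_le\<close> to be the gain of the matched edge of \<open>v\<close>, or 0 if there
  is none.\<close>

lemma utility_le_matching_state:
  assumes "disjoint M" "s \<in> states V E B" "v \<in> V"
    and "\<And>e. e \<in> incident_edges E v \<Longrightarrow> edge_contribution s e \<noteq> 0 \<Longrightarrow>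
           \<exists>e'\<in>incident_edges E v \<inter> M. gain e \<le> gain e'"
  shows "utility E f s v \<le> utility E f (matching_state M) v"
proof -
  have nonneg: "0 \<le> gain e" if "e \<in> incident_edges E v \<inter> M" for e
    using that gain_nonneg by (auto simp: incident_edges_def)
  have "gain e' \<le> sum gain (incident_edges E v \<inter> M)" if "e' \<in> incident_edges E v \<inter> M" for e'
    using that nonneg finite_incident by (intro member_le_sum) auto
  then have "gain e \<le> sum gain (incident_edges E v \<inter> M)"
    if "e \<in> incident_edges E v" "edge_contribution s e \<noteq> 0" for e
    using assms(4)[OF that] order_trans by blast
  then have "utility E f s v \<le> base_utility v + sum gain (incident_edges E v \<inter> M)"
    using assms(2,3) nonneg by (intro utility_le sum_nonneg)
  then show ?thesis
    using assms(1) by (simp add: utility_matching_state)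
qed

text \<open>An endpoint outside the deviating set \<open>D\<close> still contributes 0 off
  \<open>M\<close>, which forces the minimum to 0. Deviators can therefore activate new edges only
  among themselves.\<close>

lemma edge_contribution_deviation:
  assumes "s \<in> states V E B" "e \<in> E" "edge_contribution s e \<noteq> 0"
    and "\<And>w. w \<notin> D \<Longrightarrow> s w = matching_state M w"
  shows "e \<in> M \<or> e \<subseteq> D"
proof (rule ccontr)
  assume "\<not> ?thesis"
  then obtain w where "w \<in> e" "w \<notin> D" "e \<notin> M"
    by blast
  then have "s w e = 0"
    using assms(4) by (simp add: matching_state_def)
  then show False
    using edge_contribution_bounds[OF assms(1,2) \<open>w \<in> e\<close>] assms(3) by simp
qed

text \<open>A single deviator activates no new edge, since no edge lies inside a singleton. Two
  deviators can activate only the edge joining them, and greediness gives one of them a matched edge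
  of at least that gain.\<close>

lemma pairwise_equilibrium_greedy_matching:
  assumes "disjoint M" "\<And>e. e \<in> E \<Longrightarrow> \<exists>e'\<in>M. e \<inter> e' \<noteq> {} \<and> gain e \<le> gain e'" "M \<subseteq> E"
  shows "pairwise_equilibrium V E B f (matching_state M)"
proof -
  let ?s = "matching_state M"
  have state: "?s \<in> states V E B"
    using assms(1) by (rule matching_state_in_states)
  have "utility E f (?s(v := t)) v \<le> utility E f ?s v"
    if "v \<in> V" "t \<in> strategies E B v" for v t
  proof (rule utility_le_matching_state[OF assms(1) _ that(1)])
    show state': "?s(v := t) \<in> states V E B"
      using state that(2) by (rule states_upd)
    fix e assume e: "e \<in> incident_edges E v" "edge_contribution (?s(v := t)) e \<noteq> 0"
    then have "e \<in> E" "v \<in> e" by (auto simp: incident_edges_def)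
    then obtain u where "e = {v, u}" "u \<noteq> v"
      using edge_doubleton by metis
    then have "e \<in> M"
      using edge_contribution_deviation[OF state' \<open>e \<in> E\<close> e(2), of "{v}" M] by auto
    then show "\<exists>e'\<in>incident_edges E v \<inter> M. gain e \<le> gain e'"
      using e(1) by blast
  qed
  moreover have "\<not> improving_bilateral_deviation E B f ?s u v tu tv"
    if "u \<in> V" "v \<in> V" for u v tu tv
  proof
    assume "improving_bilateral_deviation E B f ?s u v tu tv"
    then have strat: "tu \<in> strategies E B u" "tv \<in> strategies E B v" and "u \<noteq> v"
      and less: "\<And>w. w \<in> {u, v} \<Longrightarrow> utility E f ?s w < utility E f (?s(u := tu, v := tv)) w"
      by (auto simp: improving_bilateral_deviation_def)
    let ?t = "?s(u := tu, v := tv)"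
    have state': "?t \<in> states V E B"
      using state strat by (intro states_upd)
    have used: "e \<in> M \<or> e = {u, v}" if "e \<in> E" "edge_contribution ?t e \<noteq> 0" for e
    proof -
      have "e \<in> M \<or> e \<subseteq> {u, v}"
        using edge_contribution_deviation[OF state' that, of "{u, v}" M] by auto
      moreover have "card e = 2" "card {u, v} = 2"
        using that graph \<open>u \<noteq> v\<close> by (auto simp: simple_graph_def)
      ultimately show ?thesis
        by (metis card_subset_eq finite.emptyI finite.insertI)
    qed
    \<comment> \<open>\<open>w\<close> is the deviator who will not profit: an endpoint of
      \<open>{u, v}\<close> on the matching edge dominating it. If \<open>{u, v}\<close> is not an
      edge, either deviator serves.\<close>
    obtain w where w: "w \<in> {u, v}" "{u, v} \<in> E \<longrightarrow>
        (\<exists>e'\<in>incident_edges E w \<inter> M. gain {u, v} \<le> gain e')"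
    proof (cases "{u, v} \<in> E")
      case True
      then obtain e' where "e' \<in> M" "{u, v} \<inter> e' \<noteq> {}" "gain {u, v} \<le> gain e'"
        using assms(2) by blast
      then show ?thesis
        using that assms(3) by (auto simp: incident_edges_def)
    qed (use that in blast)
    then have "w \<in> V"
      using \<open>u \<in> V\<close> \<open>v \<in> V\<close> by blast
    have "utility E f ?t w \<le> utility E f ?s w"
    proof (rule utility_le_matching_state[OF assms(1) state' \<open>w \<in> V\<close>])
      fix e assume e: "e \<in> incident_edges E w" "edge_contribution ?t e \<noteq> 0"
      then have "e \<in> E" by (simp add: incident_edges_def)
      then show "\<exists>e'\<in>incident_edges E w \<inter> M. gain e \<le> gain e'"
        using used[OF _ e(2)] w(2) e(1) by blast
    qed
    then show False
      using less[OF w(1)] by simp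
  qed
  ultimately show ?thesis
    using state unfolding pairwise_equilibrium_def nash_equilibrium_def by blast
qed

lemma exists_pairwise_equilibrium:
  "\<exists>s. pairwise_equilibrium V E B f s \<and> equal_contributions E s"
proof -
  have "{} \<notin> E"
    using graph by (auto simp: simple_graph_def)
  from greedy_matching[OF finite_edges this, of gain] obtain M where "M \<subseteq> E" "disjoint M"
    "\<forall>e\<in>E. \<exists>e'\<in>M. e \<inter> e' \<noteq> {} \<and> gain e \<le> gain e'"
    by blast
  then have "pairwise_equilibrium V E B f (matching_state M)"
    by (intro pairwise_equilibrium_greedy_matching) auto
  moreover have "equal_contributions E (matching_state M)"
    by (simp add: equal_contributions_def matching_state_def)
  ultimately show ?thesis by blast
qed

section \<open>Integrality: moving whole budgets to one edge\<close>

lemma all_in_strategy: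
  "w \<in> V \<Longrightarrow> (\<lambda>e. of_bool (e = d)) \<in> strategies E B w"
  using finite_incident[of w] uniform by (simp add: strategies_def of_bool_def)

text \<open>Both endpoints of \<open>d\<close> spend everything on it, so \<open>d\<close> reaches
  1. Every other edge at \<open>w\<close> falls to 0 because \<open>w\<close> contributes nothing
  there, whatever its other endpoint does.\<close>

lemma utility_all_in:
  assumes "s \<in> states V E B" "d \<in> incident_edges E w" "\<And>v. v \<in> d \<Longrightarrow> s v = (\<lambda>e. of_bool (e = d))"
  shows "utility E f s w = base_utility w + gain d"
proof -
  have "w \<in> d" "d \<in> E"
    using assms(2) by (auto simp: incident_edges_def)
  have "edge_contribution s e = of_bool (e = d)" if "e \<in> incident_edges E w" for e
  proof (cases "e = d")
    case True
    obtain u where "d = {w, u}"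
      using edge_doubleton \<open>w \<in> d\<close> \<open>d \<in> E\<close> by metis
    with True show ?thesis
      using assms(3) by (simp add: edge_contribution_doubleton)
  next
    case False
    then have "s w e = 0"
      using assms(3) \<open>w \<in> d\<close> by simp
    then show ?thesis
      using False that edge_contribution_bounds[OF assms(1), of e w]
      by (simp add: incident_edges_def)
  qed
  then have "utility E f s w = (\<Sum>e\<in>incident_edges E w. h e 0 + (if e = d then gain d else 0))"
    unfolding utility_eq[OF assms(1)] by (intro sum.cong) (auto simp: gain_def)
  then show ?thesis
    using finite_incident assms(2) by (simp add: sum.distrib base_utility_def)
qed

lemma integral_pairwise_equilibrium:
  assumes strict: "\<And>e. e \<in> E \<Longrightarrow> strictly_convex_on {0..} (h e)"
    and eq: "pairwise_equilibrium V E B f s"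
  shows "integral_state E s"
proof (rule ccontr)
  have state: "s \<in> states V E B"
    using eq by (simp add: pairwise_equilibrium_def nash_equilibrium_def)
  \<comment> \<open>Edge contributions lie between 0 and 1, so these are the strictly fractional
    edges.\<close>
  let ?F = "{e \<in> E. edge_contribution s e \<notin> {0, 1}}"
  assume "\<not> integral_state E s"
  then have "?F \<noteq> {}" "finite ?F"
    using finite_edges by (auto simp: integral_state_def)
  then have "Max (gain ` ?F) \<in> gain ` ?F"
    by (intro Max_in) auto
  then obtain d where d: "d \<in> ?F" "gain d = Max (gain ` ?F)"
    by (metis (lifting) imageE)
  have max: "gain e \<le> gain d" if "e \<in> ?F" for e
    unfolding d(2) using that \<open>finite ?F\<close> by (intro Max_ge) auto
  have less: "utility E f s w < base_utility w + gain d" if "w \<in> d" for w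
  proof -
    have "d \<in> E" "w \<in> V" and inc: "d \<in> incident_edges E w"
      using d that edge_subset by (auto simp: incident_edges_def)
    have pos: "0 < edge_contribution s d" "edge_contribution s d < 1"
      using edge_contribution_bounds[OF state \<open>d \<in> E\<close> that]
        edge_contribution_le_1[OF state \<open>d \<in> E\<close> that] d(1) by auto
    \<comment> \<open>\<open>d\<close> already takes a positive share of the budget of
      \<open>w\<close>, so any other used edge at \<open>w\<close> stays below 1. It is then
      fractional itself, and maximality of \<open>d\<close> applies; integral edges of larger gain
      cannot be in use at \<open>w\<close>.\<close>
    have "gain e \<le> gain d" if e: "e \<in> incident_edges E w" "edge_contribution s e \<noteq> 0" for e
    proof (cases "e = d")
      case False
      have "edge_contribution s e + edge_contribution s d =
          (\<Sum>e\<in>{e, d}. edge_contribution s e)"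
        using False by simp
      also have "\<dots> \<le> (\<Sum>e\<in>incident_edges E w. edge_contribution s e)"
        using e(1) inc finite_incident edge_contribution_bounds[OF state]
        by (intro sum_mono2) (auto simp: incident_edges_def)
      also have "\<dots> \<le> 1"
        using state \<open>w \<in> V\<close> by (rule sum_edge_contribution_le)
      finally have "edge_contribution s e < 1"
        using pos by linarith
      then show ?thesis
        using e by (intro max) (auto simp: incident_edges_def)
    qed simp
    then show ?thesis
      using state \<open>w \<in> V\<close> \<open>d \<in> E\<close> inc pos strict by (intro utility_less gain_nonneg) auto
  qed
  have "d \<in> E" "card d = 2"
    using d(1) graph by (auto simp: simple_graph_def)
  then obtain u v where uv: "d = {u, v}" "u \<noteq> v"
    by (auto simp: card_2_iff)
  \<comment> \<open>Played by both endpoints, this strategy yields each exactly the bound that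
    \<open>less\<close> shows is missed in \<open>s\<close>.\<close>
  let ?t = "\<lambda>e. of_bool (e = d) :: real"
  have "u \<in> V" "v \<in> V"
    using uv \<open>d \<in> E\<close> edge_subset by auto
  then have strat: "?t \<in> strategies E B u" "?t \<in> strategies E B v"
    by (auto intro: all_in_strategy)
  then have "s(u := ?t, v := ?t) \<in> states V E B"
    using state by (intro states_upd)
  then have "utility E f (s(u := ?t, v := ?t)) w = base_utility w + gain d" if "w \<in> d" for w
    using that \<open>d \<in> E\<close> uv(1) by (intro utility_all_in) (auto simp: incident_edges_def)
  then have "improving_bilateral_deviation E B f s u v ?t ?t"
    using uv strat less by (simp add: improving_bilateral_deviation_def)
  then show False
    using eq \<open>u \<in> V\<close> \<open>v \<in> V\<close> unfolding pairwise_equilibrium_def by blast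
qed

end

theorem theorem4p2:
  fixes V :: "'a set" and E :: "'a set set" and B :: "'a \<Rightarrow> real"
    and f :: "'a set \<Rightarrow> real \<Rightarrow> real \<Rightarrow> real" and h :: "'a set \<Rightarrow> real \<Rightarrow> real"
  assumes game: "contribution_game V E B f"
    and uniform: "\<forall>v\<in>V. B v = 1"
    and min_effort: "\<forall>e\<in>E. \<forall>x\<ge>0. \<forall>y\<ge>0. f e x y = h e (min x y)"
    and h_nonneg: "\<forall>e\<in>E. \<forall>x\<ge>0. h e x \<ge> 0"
    and h_mono: "\<forall>e\<in>E. mono_on {0..} (h e)"
    and h_convex: "\<forall>e\<in>E. convex_on {0..} (h e)"
  shows "(\<exists>s. pairwise_equilibrium V E B f s \<and> equal_contributions E s) \<and>
         ((\<forall>e\<in>E. strictly_convex_on {0..} (h e)) \<longrightarrow>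
            (\<forall>s. pairwise_equilibrium V E B f s \<longrightarrow> integral_state E s))"
proof -
  interpret unit_min_effort_game V E B f h
    using game uniform min_effort h_mono h_convex
    by unfold_locales (auto simp: contribution_game_def)
  show ?thesis
    using exists_pairwise_equilibrium integral_pairwise_equilibrium by blast
qed

end
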